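(* Let $f(x),g(x)\in\mathbb{Z}[x]$ be monic and let $n$ be an integer with $\gcd(n,\operatorname{disc}(fg))=1$. If $n$ is a Frobenius pseudoprime with respect to $f(x)$ and with respect to $g(x)$, then $n$ is a Frobenius pseudoprime with respect to $f(x)g(x)$.
   Context: For monic polynomials $g_1,g_2$ over a commutative ring $R$ with identity, a monic $h\in R[x]$ is $\operatorname{gcmd}(g_1,g_2)$ if the ideal generated by $g_1,g_2$ equals the ideal generated by $h$ (it may fail to exist). Let $f(x)\in\mathbb{Z}[x]$ be monic of degree $d$ with discriminant $\Delta$. An odd integer $n>1$ is a Frobenius probable prime with respect to $f$ if $\gcd(n,f(0)\Delta)=1$ and, with all computations in $(\mathbb{Z}/n\mathbb{Z})[x]$: (Factorization) setting $f_0=f\bmod n$ and, for $1\le i\le d$, $F_i=\operatorname{gcmd}(x^{n^i}-x,f_{i-1})$ and $f_i=f_{i-1}/F_i$, all these gcmds exist and $f_d=1$; (Frobenius) for $2\le i\le d$, $F_i(x^n)\equiv 0\pmod{F_i(x)}$; (Jacobi) with $S=\sum_{2\mid i}\deg(F_i)/i$, one has $(-1)^S=\left(\frac{\Delta}{n}\right)$ (Jacobi symbol). A Frobenius pseudoprime with respect to $f$ is a composite Frobenius probable prime with respect to $f$. $\operatorname{disc}$ denotes the discriminant. *)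

theory Defs
  imports
    "HOL-Number_Theory.Residues"
    "HOL-Algebra.Divisibility"
    "HOL-Algebra.UnivPoly"
    "Subresultants.Resultant_Prelim"
begin

text \<open>
  Polynomials over \<open>\<int>\<close> have type \<open>int poly\<close>. Polynomials over \<open>\<int>/n\<int>\<close> are the elements
  of \<^term>\<open>UP (residue_ring n)\<close>, whose elements are coefficient functions.
\<close>

definition monic_UP :: "('a, 'b) ring_scheme \<Rightarrow> (nat \<Rightarrow> 'a) \<Rightarrow> bool" where
  "monic_UP R p \<longleftrightarrow>
     p \<in> carrier (UP R) \<and> UnivPoly.coeff (UP R) p (deg R p) = \<one>\<^bsub>R\<^esub>"

text \<open>
  A relation, because the gcmd need not exist. If \<open>R\<close> is a commutative ring then at most
  one \<open>h\<close> satisfies it, since two monic polynomials dividing each other are equal.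
\<close>

definition is_gcmd ::
    "('a, 'b) ring_scheme \<Rightarrow> (nat \<Rightarrow> 'a) \<Rightarrow> (nat \<Rightarrow> 'a) \<Rightarrow> (nat \<Rightarrow> 'a) \<Rightarrow> bool" where
  "is_gcmd R g1 g2 h \<longleftrightarrow>
     monic_UP R g1 \<and> monic_UP R g2 \<and> monic_UP R h \<and> Idl\<^bsub>UP R\<^esub> {g1, g2} = Idl\<^bsub>UP R\<^esub> {h}"

definition X_pow :: "('a, 'b) ring_scheme \<Rightarrow> nat \<Rightarrow> (nat \<Rightarrow> 'a)" where
  "X_pow R k = UnivPoly.monom (UP R) \<one>\<^bsub>R\<^esub> k"

text \<open>The polynomial \<open>p(x^k)\<close>: evaluate \<open>p\<close>, with its coefficients embedded as constants, at \<open>x^k\<close>.\<close>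

definition subst_X_pow :: "('a, 'b) ring_scheme \<Rightarrow> nat \<Rightarrow> (nat \<Rightarrow> 'a) \<Rightarrow> (nat \<Rightarrow> 'a)" where
  "subst_X_pow R k p =
     UnivPoly.eval R (UP R) (\<lambda>a. UnivPoly.monom (UP R) a 0) (X_pow R k) p"

definition reduce_mod :: "int \<Rightarrow> int poly \<Rightarrow> (nat \<Rightarrow> int)" where
  "reduce_mod n f = (\<lambda>i. Polynomial.coeff f i mod n)"

text \<open>
  For monic \<open>f\<close> of degree \<open>d\<close> only: the factor \<open>1 / lead_coeff f\<close> of the general formula
  is omitted. The sign makes it the product of the squared differences of the roots; for instance
  \<open>x^2 + b x + c\<close> has discriminant \<open>b^2 - 4 c\<close>.
\<close>

definition monic_disc :: "int poly \<Rightarrow> int" where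
  "monic_disc f = (-1) ^ (degree f * (degree f - 1) div 2) * resultant f (pderiv f)"

text \<open>Intended for odd \<open>n > 0\<close>; prime factors are counted with multiplicity.\<close>

definition Jacobi :: "int \<Rightarrow> int \<Rightarrow> int" where
  "Jacobi a n = (\<Prod>p\<in>#prime_factorization n. Legendre a p)"

text \<open>
  The sequences \<open>F\<^sub>i\<close> and \<open>f\<^sub>i\<close> of the Factorization step. The equation
  \<open>fs (i - 1) = F i \<otimes> fs i\<close> determines \<open>fs i = fs (i - 1) / F i\<close>, because a monic \<open>F i\<close>
  is not a zero divisor.
\<close>

definition factorization_step ::
    "int \<Rightarrow> int poly \<Rightarrow> (nat \<Rightarrow> nat \<Rightarrow> int) \<Rightarrow> (nat \<Rightarrow> nat \<Rightarrow> int) \<Rightarrow> bool" where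
  "factorization_step n f F fs \<longleftrightarrow>
     (let R = residue_ring n; P = UP R in
        fs 0 = reduce_mod n f \<and>
        (\<forall>i\<in>{1..degree f}.
           is_gcmd R (X_pow R (nat n ^ i) \<ominus>\<^bsub>P\<^esub> X_pow R 1) (fs (i - 1)) (F i) \<and>
           fs i \<in> carrier P \<and> fs (i - 1) = F i \<otimes>\<^bsub>P\<^esub> fs i) \<and>
        fs (degree f) = \<one>\<^bsub>P\<^esub>)"

definition frobenius_step :: "int \<Rightarrow> int poly \<Rightarrow> (nat \<Rightarrow> nat \<Rightarrow> int) \<Rightarrow> bool" where
  "frobenius_step n f F \<longleftrightarrow>
     (let R = residue_ring n in
        \<forall>i\<in>{2..degree f}. F i divides\<^bsub>UP R\<^esub> subst_X_pow R (nat n) (F i))"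

text \<open>
  The exponent is the exact sum of the fractions \<open>deg(F\<^sub>i) / i\<close>, so the truncating division
  of natural numbers is not used; \<open>(-1)^S\<close> makes sense because this sum is a natural number.
\<close>

definition jacobi_step :: "int \<Rightarrow> int poly \<Rightarrow> (nat \<Rightarrow> nat \<Rightarrow> int) \<Rightarrow> bool" where
  "jacobi_step n f F \<longleftrightarrow>
     (\<exists>S::nat.
        (of_nat S :: rat) =
          (\<Sum>i | i \<in> {1..degree f} \<and> even i. of_nat (deg (residue_ring n) (F i)) / of_nat i) \<and>
        (-1) ^ S = Jacobi (monic_disc f) n)"

text \<open>Meant for monic \<open>f\<close>. The sequences \<open>F\<close> and \<open>fs\<close> are unique on the relevant indices if they exist.\<close>

definition frobenius_probable_prime :: "int \<Rightarrow> int poly \<Rightarrow> bool" where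
  "frobenius_probable_prime n f \<longleftrightarrow>
     odd n \<and> n > 1 \<and> coprime n (poly f 0 * monic_disc f) \<and>
     (\<exists>F fs. factorization_step n f F fs \<and> frobenius_step n f F \<and> jacobi_step n f F)"

definition frobenius_pseudoprime :: "int \<Rightarrow> int poly \<Rightarrow> bool" where
  "frobenius_pseudoprime n f \<longleftrightarrow>
     \<not> Factorial_Ring.prime n \<and> frobenius_probable_prime n f"

end

theory Submission
  imports
    Defs
    "HOL-Computational_Algebra.Fundamental_Theorem_Algebra"
    "HOL-Number_Theory.Euler_Criterion"
    "Subresultants.Subresultant"
begin

text \<open>
  Write \<open>F\<^sub>i, f\<^sub>i\<close> and \<open>G\<^sub>i, g\<^sub>i\<close> for the sequences of \<open>f\<close> and \<open>g\<close>, continued by \<open>1\<close>. Since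
  \<open>disc(fg) = disc(f) disc(g) Res(f, g)\<^sup>2\<close>, the resultant is a unit modulo \<open>n\<close>, so \<open>f\<close> and \<open>g\<close>, and
  with them their divisors \<open>f\<^sub>i\<close> and \<open>g\<^sub>i\<close>, generate the unit ideal of \<open>(\<int>/n\<int>)[x]\<close>. For comaximal
  \<open>b, c\<close> one has \<open>(a, b)(a, c) = (a, bc)\<close>, so the sequences of \<open>fg\<close> are \<open>F\<^sub>i G\<^sub>i\<close> and \<open>f\<^sub>i g\<^sub>i\<close>. The
  Frobenius step is inherited because \<open>p(x) \<mapsto> p(x\<^sup>n)\<close> is a ring homomorphism, and the Jacobi step because
  degrees of monic polynomials add up while \<open>Res(f, g)\<^sup>2\<close> has Jacobi symbol \<open>1\<close>.
\<close>

section \<open>Resultants and discriminants\<close>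

text \<open>The resultant is the 0-th subresultant, a determinant with polynomial entries in one
  row, so Laplace expansion along that row produces the coefficients \<open>p\<close> and
  \<open>q\<close>. For two constants the matrix is empty and the resultant is 1, which need not lie
  in the ideal.\<close>

lemma resultant_mem_ideal:
  fixes f g :: "'a :: comm_ring_1 poly"
  assumes "degree f + degree g \<noteq> 0"
  shows "\<exists>p q. [:resultant f g:] = p * f + q * g"
proof -
  define N where "N = degree f + degree g"
  define M where "M = subresultant_mat 0 f g"
  define C where "C = (\<lambda>j. cofactor M (N - 1) j)"
  have N: "N - 1 < N" using assms by (simp add: N_def)
  have "M \<in> carrier_mat N N"
    by (rule carrier_matI) (simp_all add: M_def N_def)
  \<comment> \<open>The last row of the subresultant matrix consists of multiples of \<open>f\<close> and \<open>g\<close>.\<close>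
  from laplace_expansion_row[OF this N]
  have "[:resultant f g:] = (\<Sum>j<N. M $$ (N - 1, j) * C j)"
    by (simp add: subresultant_resultant[symmetric] subresultant_def M_def C_def)
  also have "\<dots> = (\<Sum>j<N. (if j < degree g then monom 1 (degree g - 1 - j) * C j else 0) * f +
      (if j < degree g then 0 else monom 1 (degree f - 1 - (j - degree g)) * C j) * g)"
    by (rule sum.cong[OF refl])
      (use N in \<open>auto simp: M_def N_def subresultant_index_mat Let_def ac_simps\<close>)
  finally show ?thesis
    unfolding sum.distrib sum_distrib_right[symmetric] by blast
qed

section \<open>Resultants as products over roots\<close>

lemma poly_prod_linear_factors:
  fixes A :: "'a :: comm_ring_1 multiset"
  shows "poly (smult c (\<Prod>a\<in>#A. [:-a, 1:])) x = c * (\<Prod>a\<in>#A. x - a)"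
  by (simp add: poly_prod_mset)

lemma prod_mset_const_mult:
  "(\<Prod>a\<in>#A. c * h a :: 'a :: comm_monoid_mult) = c ^ size A * (\<Prod>a\<in>#A. h a)"
  by (induction A) (auto simp: ac_simps)

text \<open>Up to sign, both products are \<open>c ^ size B * d ^ size A\<close> times the double
  product of all differences \<open>b - a\<close>. Each of the \<open>size A * size B\<close> pairs
  contributes one sign. This trades a product over the roots of \<open>f\<close> for one over the
  roots of \<open>g\<close>.\<close>

lemma prod_roots_swap:
  fixes f g :: "'a :: idom poly"
  assumes f: "f = smult c (\<Prod>a\<in>#A. [:-a, 1:])" and g: "g = smult d (\<Prod>b\<in>#B. [:-b, 1:])"
  shows "c ^ size B * (\<Prod>a\<in>#A. poly g a) =
    (-1) ^ (size A * size B) * (d ^ size A * (\<Prod>b\<in>#B. poly f b))"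
proof -
  have neg: "(\<Prod>b\<in>#B. a - b) = (- 1) ^ size B * (\<Prod>b\<in>#B. b - a)" for a :: 'a
    using prod_mset_const_mult[of "-1" "\<lambda>b. b - a" B] by simp
  have swap: "(\<Prod>a\<in>#A. \<Prod>b\<in>#B. b - a) = (\<Prod>b\<in>#B. \<Prod>a\<in>#A. b - a)"
    by (rule prod_mset.swap)
  show ?thesis
    unfolding f g poly_prod_linear_factors prod_mset_const_mult neg swap
    by (simp add: power_mult[symmetric] ac_simps)
qed

lemma degree_prod_linear_factors:
  fixes f :: "'a :: idom poly"
  assumes "f = smult c (\<Prod>a\<in>#A. [:-a, 1:])" "f \<noteq> 0"
  shows "degree f = size A" "lead_coeff f = c"
proof -
  have nz: "(\<Prod>a\<in>#A. [:-a, 1:]) \<noteq> 0" for A :: "'a multiset"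
    by (auto simp: prod_mset_zero_iff)
  have lc: "lead_coeff (\<Prod>a\<in>#A. [:-a, 1:]) = 1" for A :: "'a multiset"
    by (induction A) (simp_all only: image_mset_empty image_mset_add_mset prod_mset.empty
        prod_mset.add_mset lead_coeff_mult, simp_all)
  have deg: "degree (\<Prod>a\<in>#A. [:-a, 1:]) = size A" for A :: "'a multiset"
    by (induction A) (use nz in \<open>simp_all add: degree_mult_eq del: mult_pCons_left\<close>)
  show "degree f = size A" "lead_coeff f = c"
    using assms(2) lc[of A] deg[of A] unfolding assms(1) by auto
qed

text \<open>
  Induction along the Euclidean algorithm: \<open>f\<close> and \<open>f mod g\<close> agree at the roots of \<open>g\<close>. The product is
  taken over the roots of \<open>g\<close>, not of \<open>f\<close>, for this reason.
\<close>

lemma resultant_roots_aux: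
  fixes f g :: "'a :: alg_closed_field poly"
  assumes "f \<noteq> 0" "g \<noteq> 0" "degree g \<le> degree f"
    and "g = smult d (\<Prod>b\<in>#B. [:-b, 1:])"
  shows "resultant f g = (-1) ^ (degree f * degree g) * (d ^ degree f * (\<Prod>b\<in>#B. poly f b))"
  using assms
proof (induction "degree g" arbitrary: f g d B rule: less_induct)
  case less
  note d = degree_prod_linear_factors[OF less.prems(4,2)]
  define h where "h = f mod g"
  have fgh: "f + (- (f div g)) * g = h"
    by (simp add: h_def minus_div_mult_eq_mod[symmetric])
  have root: "poly g b = 0" if "b \<in># B" for b
    unfolding less.prems(4) poly_prod_linear_factors using that by (auto simp: prod_mset_zero_iff)
  have "poly h b = poly f b" if "b \<in># B" for b
    using root[OF that] by (simp add: fgh[symmetric])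
  hence fh: "(\<Prod>b\<in>#B. poly f b) = (\<Prod>b\<in>#B. poly h b)"
    by (intro arg_cong[of _ _ prod_mset] image_mset_cong) auto
  \<comment> \<open>The first two cases end the Euclidean algorithm. A nonzero constant remainder is
    separate because the formula relating the 0-th subresultants takes another form when the
    remainder has degree 0.\<close>
  consider "degree g = 0" | "degree g > 0" "h = 0" | "degree g > 0" "h \<noteq> 0" "degree h = 0"
    | "degree h > 0" "h \<noteq> 0" "degree g > 0"
    by (cases "degree g"; cases "degree h") auto
  thus ?case
  proof cases
    case 1
    hence "g = [:d:]" using d by (metis degree_eq_zeroE lead_coeff_pCons(2) pCons_0_0)
    thus ?thesis using 1 d by simp
  next
    case 2
    hence "f = (f div g) * g" using fgh by simp
    from subresultant_product[OF this less.prems(3), of 0] 2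
    have "resultant f g = 0" by (simp add: subresultant_resultant)
    \<comment> \<open>The product over the roots vanishes only because there is a root; an empty
      product would be 1.\<close>
    moreover have "B \<noteq> {#}" using 2 d by auto
    ultimately show ?thesis
      using fh \<open>h = 0\<close> by (auto simp: prod_mset_zero_iff)
  next
    case 3
    then obtain k where k: "h = [:k:]" by (metis degree_eq_zeroE)
    hence poly_const: "poly [:k:] = (\<lambda>_. k)" by (simp add: fun_eq_iff)
    have lt: "degree h < degree g" using 3 by simp
    from BT_lemma_1_13[OF fgh less.prems(3)] lt 3
    have "resultant f g = (-1) ^ (degree f * degree g) * d ^ degree f * k ^ (degree g - 1) * k"
      by (simp add: subresultant_resultant k d(2))
    moreover have "k ^ (degree g - 1) * k = k ^ degree g"
      using 3(1) by (rule power_minus_mult)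
    moreover have "(\<Prod>b\<in>#B. poly h b) = k ^ degree g"
      by (simp add: k poly_const d(1))
    ultimately show ?thesis unfolding fh by (simp only: mult.assoc)
  next
    case 4
    have lt: "degree h < degree g" using degree_mod_less[OF less.prems(2), of f] 4(2) by (simp add: h_def)
    obtain A where A: "h = smult (lead_coeff h) (\<Prod>x\<in>#A. [:-x, 1:])"
      using alg_closed_imp_factorization[OF 4(2)] by auto
    note dA = degree_prod_linear_factors[OF A 4(2)]
    \<comment> \<open>The induction hypothesis yields a product over the roots of \<open>h\<close>.
      Swapping brings it back to the roots of \<open>g\<close>, where \<open>h\<close> and
      \<open>f\<close> agree, and cancels the sign.\<close>
    have "resultant g h = (-1) ^ (degree g * degree h) * (lead_coeff h ^ degree g * (\<Prod>b\<in>#A. poly g b))"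
      by (rule less.hyps) (use lt less.prems 4 A in auto)
    also have "\<dots> = d ^ degree h * (\<Prod>b\<in>#B. poly h b)"
      using prod_roots_swap[OF less.prems(4) A] dA d by simp
    finally have *: "resultant g h = d ^ degree h * (\<Prod>b\<in>#B. poly h b)" .
    have "resultant f g = (-1) ^ (degree f * degree g) * d ^ (degree f - degree h) * resultant g h"
      using BT_lemma_1_12[OF fgh less.prems(3), of 0] lt 4 d by (simp add: subresultant_resultant)
    moreover have "d ^ (degree f - degree h) * (d ^ degree h * x) = d ^ degree f * x" for x
      using lt less.prems(3) by (simp flip: mult.assoc power_add)
    ultimately show ?thesis unfolding * fh by (simp only: mult.assoc)
  qed
qed

text \<open>If \<open>degree g \<le> degree f\<close>, the product over the roots of
  \<open>g\<close> from \<open>resultant_roots_aux\<close> is swapped to the roots of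
  \<open>f\<close>. Otherwise the arguments of the resultant are exchanged first, and the two signs
  cancel.\<close>

lemma resultant_roots:
  fixes f g :: "'a :: alg_closed_field poly"
  assumes "f \<noteq> 0" and f: "f = smult c (\<Prod>a\<in>#A. [:-a, 1:])"
  shows "resultant f g = c ^ degree g * (\<Prod>a\<in>#A. poly g a)"
proof (cases "g = 0")
  case True
  \<comment> \<open>Both sides are \<open>0 ^ degree f\<close>; this also covers constant
    \<open>f\<close>, where they equal 1.\<close>
  have "resultant f 0 = 0 ^ degree f" using resultant_const(2)[of f 0] by (simp only: pCons_0_0)
  moreover have "(\<Prod>a\<in>#A. poly 0 a) = 0 ^ size A"
    by (simp only: poly_0 image_mset_const_eq prod_mset_replicate_mset)
  ultimately show ?thesis
    using True degree_prod_linear_factors(1)[OF f assms(1)]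
    by (simp only: degree_0 power_0 mult_1)
next
  case False
  then obtain B where B: "g = smult (lead_coeff g) (\<Prod>x\<in>#B. [:-x, 1:])"
    using alg_closed_imp_factorization[OF False] by auto
  note d = degree_prod_linear_factors[OF f assms(1)] degree_prod_linear_factors[OF B False]
  show ?thesis
  proof (cases "degree g \<le> degree f")
    case True
    show ?thesis
      using resultant_roots_aux[OF assms(1) False True B] prod_roots_swap[OF f B] d by simp
  next
    case F: False
    hence "resultant g f = (-1) ^ (degree g * degree f) * (c ^ degree g * (\<Prod>b\<in>#A. poly g b))"
      by (intro resultant_roots_aux[OF False assms(1) _ f]) auto
    moreover have "(-1 :: 'a) ^ (degree f * degree g) * ((-1) ^ (degree g * degree f) * x) = x" for x
      by (simp add: mult.assoc[symmetric] power_add[symmetric] mult.commute[of "degree g"])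
    ultimately show ?thesis by (simp only: resultant_swap[of f g])
  qed
qed

section \<open>Complex roots of integer polynomials and the discriminant of a product\<close>

lemma of_int_resultant_roots:
  fixes f g :: "int poly"
  assumes "f \<noteq> 0" and "map_poly of_int f = (\<Prod>a\<in>#A. [:-a, 1:] :: complex poly)"
  shows "of_int (resultant f g) = (\<Prod>a\<in>#A. poly (map_poly of_int g) a)"
proof -
  have "resultant (map_poly of_int f) (map_poly of_int g :: complex poly) =
    1 ^ degree (map_poly of_int g :: complex poly) * (\<Prod>a\<in>#A. poly (map_poly of_int g) a)"
  proof (rule resultant_roots)
    show "map_poly of_int f \<noteq> (0 :: complex poly)" using assms(1) by simp
  qed (simp only: assms(2) smult_1_left)
  thus ?thesis by (simp add: of_int_hom.resultant_hom)
qed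

lemma monic_int_poly_splits:
  fixes f :: "int poly"
  assumes "lead_coeff f = 1"
  obtains A where "map_poly of_int f = (\<Prod>a\<in>#A. [:-a, 1:] :: complex poly)"
proof -
  have "map_poly of_int f \<noteq> (0 :: complex poly)" using assms by auto
  from alg_closed_imp_factorization[OF this] obtain A
    where "map_poly of_int f = smult (lead_coeff (map_poly of_int f)) (\<Prod>a\<in>#A. [:-a, 1:] :: complex poly)"
    by blast
  moreover have "lead_coeff (map_poly of_int f :: complex poly) = 1" using assms by simp
  ultimately show ?thesis using that by (metis smult_1_left)
qed

text \<open>With T(k) = k(k-1)/2 one has T(m+n) = T(m) + T(n) + mn, and the extra factor cancels the
  mixed term. In \<open>monic_disc_mult\<close> that factor comes from exchanging the arguments of a
  resultant.\<close>

lemma minus_one_power_triangle_add: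
  "(-1 :: 'a :: comm_ring_1) ^ ((m + n) * (m + n - 1) div 2) * (-1) ^ (n * m) =
    (-1) ^ (m * (m - 1) div 2) * (-1) ^ (n * (n - 1) div 2)"
proof -
  \<comment> \<open>Evenness makes the truncating division by 2 exact.\<close>
  have even: "even (k * (k - 1))" for k :: nat by (cases k) auto
  obtain i j where ij: "m * (m - 1) = 2 * i" "n * (n - 1) = 2 * j"
    using even[of m] even[of n] unfolding dvd_def by blast
  have "(m + n) * (m + n - 1) = m * (m - 1) + n * (n - 1) + 2 * (m * n)"
    by (cases m; cases n) (auto simp: algebra_simps)
  hence "(m + n) * (m + n - 1) div 2 = i + j + m * n"
    unfolding ij by simp
  moreover have "(-1 :: 'a) ^ (m * n) * (-1) ^ (n * m) = 1"
    by (simp add: power_add[symmetric] mult.commute[of n])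
  ultimately show ?thesis
    unfolding ij by (simp only: power_add mult.assoc) simp
qed

text \<open>Over the complex roots, \<open>(fg)' = f'g\<close> at a root of \<open>f\<close>, and \<open>(fg)' = fg'\<close> at a root of \<open>g\<close>.\<close>

lemma monic_disc_mult:
  fixes f g :: "int poly"
  assumes f: "lead_coeff f = 1" and g: "lead_coeff g = 1"
  shows "monic_disc (f * g) = monic_disc f * monic_disc g * (resultant f g)\<^sup>2"
proof -
  let ?c = "map_poly of_int :: int poly \<Rightarrow> complex poly"
  obtain A where A: "?c f = (\<Prod>a\<in>#A. [:-a, 1:])" by (rule monic_int_poly_splits[OF f])
  obtain B where B: "?c g = (\<Prod>a\<in>#B. [:-a, 1:])" by (rule monic_int_poly_splits[OF g])
  have nz: "f \<noteq> 0" "g \<noteq> 0" "f * g \<noteq> 0" using f g by auto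
  have AB: "?c (f * g) = (\<Prod>a\<in>#A + B. [:-a, 1:])"
    by (simp add: of_int_poly_hom.hom_mult A B)
  have root: "poly (\<Prod>a\<in>#C. [:-a, 1:]) x = 0" if x: "x \<in># C" for C and x :: complex
  proof -
    obtain D where "C = add_mset x D" using multi_member_split[OF x] by (rule exE)
    thus ?thesis by simp
  qed
  have fA: "poly (?c f) a = 0" if "a \<in># A" for a unfolding A using that by (rule root)
  have gB: "poly (?c g) a = 0" if "a \<in># B" for a unfolding B using that by (rule root)
  have "(\<Prod>a\<in>#A. poly (?c (pderiv (f * g))) a) = (\<Prod>a\<in>#A. poly (?c (pderiv f)) a * poly (?c g) a)"
    by (intro arg_cong[of _ _ prod_mset] image_mset_cong)
      (simp add: pderiv_mult of_int_poly_hom.hom_mult of_int_poly_hom.hom_add fA mult.commute)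
  moreover have "(\<Prod>a\<in>#B. poly (?c (pderiv (f * g))) a) = (\<Prod>a\<in>#B. poly (?c f) a * poly (?c (pderiv g)) a)"
    by (intro arg_cong[of _ _ prod_mset] image_mset_cong)
      (simp add: pderiv_mult of_int_poly_hom.hom_mult of_int_poly_hom.hom_add gB mult.commute)
  ultimately have "of_int (resultant (f * g) (pderiv (f * g))) = (of_int (resultant f (pderiv f) * resultant f g *
      (resultant g f * resultant g (pderiv g))) :: complex)"
    using of_int_resultant_roots[OF nz(3) AB] of_int_resultant_roots[OF nz(1) A]
      of_int_resultant_roots[OF nz(2) B]
    by (simp add: prod_mset.distrib)
  hence res: "resultant (f * g) (pderiv (f * g)) = resultant f (pderiv f) * resultant f g *
      (resultant g f * resultant g (pderiv g))"
    by (simp only: of_int_eq_iff)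
  have deg: "degree (f * g) = degree f + degree g"
    using nz by (simp add: degree_mult_eq)
  have "monic_disc (f * g) =
    (-1) ^ ((degree f + degree g) * (degree f + degree g - 1) div 2) * (-1) ^ (degree g * degree f) *
      (resultant f (pderiv f) * resultant g (pderiv g) * (resultant f g)\<^sup>2)"
    unfolding monic_disc_def res deg resultant_swap[of g f] power2_eq_square
    by (simp only: ac_simps)
  also have "\<dots> = monic_disc f * monic_disc g * (resultant f g)\<^sup>2"
    unfolding minus_one_power_triangle_add monic_disc_def by (simp only: ac_simps)
  finally show ?thesis .
qed

section \<open>Jacobi symbols\<close>

text \<open>By Euler's criterion both sides are congruent modulo \<open>p\<close>. Both lie in {-1,
  0, 1}, so they differ by at most 2, and \<open>2 < p\<close> forces equality.\<close>

lemma Legendre_mult: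
  fixes p :: nat
  assumes "Factorial_Ring.prime p" "2 < p"
  shows "Legendre (a * b) (int p) = Legendre a (int p) * Legendre b (int p)"
proof -
  have "[Legendre (a * b) (int p) = a ^ ((p - 1) div 2) * b ^ ((p - 1) div 2)] (mod int p)"
    using euler_criterion[OF assms, of "a * b"] by (simp only: power_mult_distrib)
  moreover have "[Legendre a (int p) * Legendre b (int p) = a ^ ((p - 1) div 2) * b ^ ((p - 1) div 2)] (mod int p)"
    by (intro cong_mult euler_criterion[OF assms])
  ultimately have "[Legendre (a * b) (int p) = Legendre a (int p) * Legendre b (int p)] (mod int p)"
    using cong_sym cong_trans by blast
  hence dvd: "int p dvd Legendre (a * b) (int p) - Legendre a (int p) * Legendre b (int p)"
    by (simp add: cong_iff_dvd_diff)
  have "Legendre x (int p) \<in> {-1, 0, 1}" for x by (simp add: Legendre_def)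
  from this[of a] this[of b] this[of "a * b"]
  have "\<bar>Legendre (a * b) (int p) - Legendre a (int p) * Legendre b (int p)\<bar> < \<bar>int p\<bar>"
    using assms(2) by auto
  thus ?thesis
    using dvd_imp_le_int[OF _ dvd] by (metis eq_iff_diff_eq_0 not_less)
qed

lemma Jacobi_mult:
  assumes "odd n"
  shows "Jacobi (a * b) n = Jacobi a n * Jacobi b n"
proof -
  have "Legendre (a * b) p = Legendre a p * Legendre b p" if "p \<in># prime_factorization n" for p
  proof -
    have prime: "Factorial_Ring.prime p" using that by (rule in_prime_factors_imp_prime)
    have "p dvd n" using that by (rule in_prime_factors_imp_dvd)
    \<comment> \<open>Oddness of \<open>n\<close> is what makes \<open>Legendre_mult\<close>
      applicable to every prime factor.\<close>
    hence "p \<noteq> 2" using assms by blast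
    hence "2 < p" using prime_ge_2_int[OF prime] by simp
    moreover obtain q where q: "p = int q" using \<open>2 < p\<close> by (cases p) auto
    ultimately show ?thesis
      unfolding q using Legendre_mult prime[unfolded q prime_nat_int_transfer] by simp
  qed
  thus ?thesis
    unfolding Jacobi_def prod_mset.distrib[symmetric]
    by (intro arg_cong[of _ _ prod_mset] image_mset_cong)
qed

lemma Jacobi_square:
  assumes "coprime n a"
  shows "Jacobi (a\<^sup>2) n = 1"
proof -
  have "Legendre (a\<^sup>2) p = 1" if "p \<in># prime_factorization n" for p
  proof -
    have p: "Factorial_Ring.prime p" "p dvd n"
      using that by (auto intro: in_prime_factors_imp_prime in_prime_factors_imp_dvd)
    hence "\<not> p dvd a" using assms
      by (metis coprime_common_divisor not_prime_unit)
    hence "\<not> [a\<^sup>2 = 0] (mod p)"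
      using p(1) by (simp add: cong_0_iff prime_dvd_power_iff)
    moreover have "QuadRes p (a\<^sup>2)" unfolding QuadRes_def using cong_refl by blast
    ultimately show ?thesis by (simp add: Legendre_def)
  qed
  hence "Jacobi (a\<^sup>2) n = (\<Prod>p\<in>#prime_factorization n. 1)"
    unfolding Jacobi_def by (intro arg_cong[of _ _ prod_mset] image_mset_cong)
  thus ?thesis by simp
qed

section \<open>Comaximal monic polynomials and gcmds\<close>

text \<open>The ideal on the left is the sum of the two principal ideals. This turns the ideal
  equation defining a gcmd into divisibilities and a Bezout identity, which can be handled
  elementwise.\<close>

lemma (in cring) genideal_insert_eq_genideal_iff:
  assumes "a \<in> carrier R" "b \<in> carrier R" "h \<in> carrier R"
  shows "Idl {a, b} = Idl {h} \<longleftrightarrow>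
    h divides a \<and> h divides b \<and> (\<exists>u\<in>carrier R. \<exists>v\<in>carrier R. h = u \<otimes> a \<oplus> v \<otimes> b)"
proof -
  let ?S = "PIdl a <+>\<^bsub>R\<^esub> PIdl b"
  have S: "x \<in> ?S \<longleftrightarrow> (\<exists>u\<in>carrier R. \<exists>v\<in>carrier R. x = u \<otimes> a \<oplus> v \<otimes> b)" for x
    unfolding set_add_def' cgenideal_def by blast
  have "Idl {a, b} = ?S"
  proof
    have "a = \<one> \<otimes> a \<oplus> \<zero> \<otimes> b" "b = \<zero> \<otimes> a \<oplus> \<one> \<otimes> b" using assms by simp_all
    hence "a \<in> ?S" "b \<in> ?S" unfolding S using one_closed zero_closed by blast+
    thus "Idl {a, b} \<subseteq> ?S"
      using assms by (intro genideal_minimal add_ideals cgenideal_ideal) simp_all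
  next
    interpret I: ideal "Idl {a, b}" R
      using assms by (intro genideal_ideal) simp
    have "a \<in> Idl {a, b}" "b \<in> Idl {a, b}"
      using genideal_self[of "{a, b}"] assms by simp_all
    thus "?S \<subseteq> Idl {a, b}"
      by (auto simp: S intro!: I.a_closed I.I_l_closed)
  qed
  hence comb: "h \<in> Idl {a, b} \<longleftrightarrow> (\<exists>u\<in>carrier R. \<exists>v\<in>carrier R. h = u \<otimes> a \<oplus> v \<otimes> b)"
    using S by simp
  have dvd: "h divides x \<longleftrightarrow> x \<in> Idl {h}" for x
  proof -
    have "h divides x \<longleftrightarrow> (\<exists>c\<in>carrier R. x = c \<otimes> h)"
      unfolding factor_def using assms(3) by (intro bex_cong refl) (simp add: m_comm)
    also have "\<dots> \<longleftrightarrow> x \<in> Idl {h}"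
      unfolding cgenideal_eq_genideal[OF assms(3), symmetric] cgenideal_def by blast
    finally show ?thesis .
  qed
  have sub: "Idl S \<subseteq> Idl T \<longleftrightarrow> S \<subseteq> Idl T" if "S \<subseteq> carrier R" "T \<subseteq> carrier R" for S T
    using genideal_minimal[OF genideal_ideal[OF that(2)]] genideal_self[OF that(1)]
    by (intro iffI) (simp_all add: subset_trans)
  have "Idl {a, b} = Idl {h} \<longleftrightarrow> a \<in> Idl {h} \<and> b \<in> Idl {h} \<and> h \<in> Idl {a, b}"
    unfolding set_eq_subset using sub[of "{a, b}" "{h}"] sub[of "{h}" "{a, b}"] assms by simp
  thus ?thesis unfolding dvd comb .
qed

lemma (in cring) genideal_mult_comaximal:
  assumes car: "a \<in> carrier R" "b \<in> carrier R" "c \<in> carrier R" "h \<in> carrier R" "k \<in> carrier R"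
    and st: "s \<in> carrier R" "t \<in> carrier R" "s \<otimes> b \<oplus> t \<otimes> c = \<one>"
    and hk: "Idl {a, b} = Idl {h}" "Idl {a, c} = Idl {k}"
  shows "Idl {a, b \<otimes> c} = Idl {h \<otimes> k}"
proof -
  obtain u v where uv: "u \<in> carrier R" "v \<in> carrier R" "h = u \<otimes> a \<oplus> v \<otimes> b"
    and "h divides a" "h divides b"
    using hk(1) genideal_insert_eq_genideal_iff[of a b h] car by auto
  then obtain a1 b1 where h: "a1 \<in> carrier R" "a = h \<otimes> a1" "b1 \<in> carrier R" "b = h \<otimes> b1"
    unfolding factor_def by blast
  obtain u' v' where uv': "u' \<in> carrier R" "v' \<in> carrier R" "k = u' \<otimes> a \<oplus> v' \<otimes> c"
    and "k divides a" "k divides c"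
    using hk(2) genideal_insert_eq_genideal_iff[of a c k] car by auto
  then obtain a2 c2 where k: "a2 \<in> carrier R" "a = k \<otimes> a2" "c2 \<in> carrier R" "c = k \<otimes> c2"
    unfolding factor_def by blast
  \<comment> \<open>Comaximality gives \<open>h \<otimes> k divides a\<close>: in
    \<open>s b a\<close> take \<open>h\<close> from \<open>b\<close> and \<open>k\<close> from
    \<open>a\<close>, and in \<open>t c a\<close> take \<open>k\<close> from \<open>c\<close> and
    \<open>h\<close> from \<open>a\<close>.\<close>
  have "a = (s \<otimes> b \<oplus> t \<otimes> c) \<otimes> a" using car(1) st(3) by simp
  also have "\<dots> = s \<otimes> b \<otimes> a \<oplus> t \<otimes> c \<otimes> a" using car st(1,2) by (intro l_distr) simp_all
  also have "s \<otimes> b \<otimes> a = s \<otimes> (h \<otimes> b1) \<otimes> (k \<otimes> a2)" using h(4) k(2) by simp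
  also have "t \<otimes> c \<otimes> a = t \<otimes> (k \<otimes> c2) \<otimes> (h \<otimes> a1)" using k(4) h(2) by simp
  also have "s \<otimes> (h \<otimes> b1) \<otimes> (k \<otimes> a2) \<oplus> t \<otimes> (k \<otimes> c2) \<otimes> (h \<otimes> a1) =
      h \<otimes> k \<otimes> (s \<otimes> b1 \<otimes> a2 \<oplus> t \<otimes> c2 \<otimes> a1)"
    using car(4,5) st(1,2) h(1,3) k(1,3) by (simp add: r_distr m_ac)
  finally have "h \<otimes> k divides a"
    by (rule dividesI[rotated]) (use st(1,2) h(1,3) k(1,3) in simp)
  moreover have "h \<otimes> k divides b \<otimes> c"
  proof (rule dividesI)
    show "b \<otimes> c = h \<otimes> k \<otimes> (b1 \<otimes> c2)"
      unfolding h(4) k(4) using car(4,5) h(3) k(3) by (simp add: m_ac)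
  qed (use h(3) k(3) in simp)
  \<comment> \<open>Multiply the Bezout identities of \<open>h\<close> and \<open>k\<close>: every
    term of the product contains \<open>a\<close>, except \<open>v v' b c\<close>.\<close>
  moreover have "\<exists>x\<in>carrier R. \<exists>y\<in>carrier R. h \<otimes> k = x \<otimes> a \<oplus> y \<otimes> (b \<otimes> c)"
  proof (intro bexI)
    show "h \<otimes> k = (u \<otimes> u' \<otimes> a \<oplus> u \<otimes> v' \<otimes> c \<oplus> v \<otimes> u' \<otimes> b) \<otimes> a \<oplus> (v \<otimes> v') \<otimes> (b \<otimes> c)"
      unfolding uv(3) uv'(3) using car(1-3) uv(1,2) uv'(1,2)
      by (simp add: l_distr r_distr m_ac a_ac)
  qed (use car(1-3) uv(1,2) uv'(1,2) in simp_all)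
  ultimately show ?thesis
    using car by (simp add: genideal_insert_eq_genideal_iff)
qed

section \<open>Monic polynomials and gcmds over a commutative ring\<close>

context UP_cring
begin

text \<open>In the convolution sum for the coefficient at the sum of the degrees, only the product
  of the two leading coefficients survives. It is 1, hence nonzero, so degrees add even in the
  presence of zero divisors.\<close>

lemma
  assumes ntriv: "\<one> \<noteq> \<zero>" and p: "monic_UP R p" and q: "monic_UP R q"
  shows deg_mult_monic: "deg R (p \<otimes>\<^bsub>P\<^esub> q) = deg R p + deg R q"
    and monic_UP_mult: "monic_UP R (p \<otimes>\<^bsub>P\<^esub> q)"
proof -
  have car: "p \<in> carrier P" "q \<in> carrier P"
    and lc: "UnivPoly.coeff P p (deg R p) = \<one>" "UnivPoly.coeff P q (deg R q) = \<one>"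
    using p q by (auto simp: monic_UP_def P_def)
  have "UnivPoly.coeff P (p \<otimes>\<^bsub>P\<^esub> q) (deg R p + deg R q) =
    (\<Oplus>i\<in>{..deg R p + deg R q}. if deg R p = i then \<one> else \<zero>)"
    unfolding coeff_mult[OF car]
  proof (rule R.finsum_cong')
    fix i assume i: "i \<in> {..deg R p + deg R q}"
    consider "i = deg R p" | "i < deg R p" | "deg R p < i" by linarith
    thus "UnivPoly.coeff P p i \<otimes> UnivPoly.coeff P q (deg R p + deg R q - i) =
        (if deg R p = i then \<one> else \<zero>)"
      using i car lc by cases (auto simp: deg_aboveD)
  qed auto
  also have "\<dots> = \<one>"
    using R.finsum_singleton[of "deg R p" "{..deg R p + deg R q}" "\<lambda>_. \<one>"] by auto
  finally have c: "UnivPoly.coeff P (p \<otimes>\<^bsub>P\<^esub> q) (deg R p + deg R q) = \<one>" .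
  show d: "deg R (p \<otimes>\<^bsub>P\<^esub> q) = deg R p + deg R q"
    using car c ntriv by (intro antisym deg_mult_ring deg_belowI) auto
  show "monic_UP R (p \<otimes>\<^bsub>P\<^esub> q)"
    using car c d by (simp add: monic_UP_def P_def[symmetric])
qed

lemma monic_UP_one: "monic_UP R \<one>\<^bsub>P\<^esub>"
  by (simp add: monic_UP_def P_def[symmetric])

text \<open>Beyond the degree of \<open>f\<close> no gcmd is given from which monicity of this
  polynomial could be read off, yet the padded sequence needs it there.\<close>

lemma monic_UP_X_pow_minus_X:
  assumes "\<one> \<noteq> \<zero>" "1 < k"
  shows "monic_UP R (X_pow R k \<ominus>\<^bsub>P\<^esub> X_pow R 1)"
proof -
  let ?p = "UnivPoly.monom P \<one> k \<ominus>\<^bsub>P\<^esub> UnivPoly.monom P \<one> 1"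
  have c: "UnivPoly.coeff P ?p k = \<one>"
    using assms by (simp add: R.minus_eq)
  have "deg R ?p = k"
    using assms c by (intro antisym deg_aboveI deg_belowI) (auto simp: R.minus_eq)
  thus ?thesis
    using c by (simp add: monic_UP_def X_pow_def P_def[symmetric])
qed

lemma is_gcmd_mult:
  assumes ntriv: "\<one> \<noteq> \<zero>" and h: "is_gcmd R a b h" and k: "is_gcmd R a c k"
    and "s \<in> carrier P" "t \<in> carrier P" "s \<otimes>\<^bsub>P\<^esub> b \<oplus>\<^bsub>P\<^esub> t \<otimes>\<^bsub>P\<^esub> c = \<one>\<^bsub>P\<^esub>"
  shows "is_gcmd R a (b \<otimes>\<^bsub>P\<^esub> c) (h \<otimes>\<^bsub>P\<^esub> k)"
proof -
  have "a \<in> carrier P" "b \<in> carrier P" "c \<in> carrier P" "h \<in> carrier P" "k \<in> carrier P"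
    using h k by (auto simp: is_gcmd_def monic_UP_def P_def)
  from P.genideal_mult_comaximal[OF this assms(4-6)] h k show ?thesis
    unfolding is_gcmd_def P_def[symmetric] by (auto intro: monic_UP_mult[OF ntriv])
qed

text \<open>This justifies continuing the sequences by 1: once a quotient is 1, the next gcmd and
  the next quotient can be taken to be 1.\<close>

lemma is_gcmd_one:
  assumes "monic_UP R a"
  shows "is_gcmd R a \<one>\<^bsub>P\<^esub> \<one>\<^bsub>P\<^esub>"
proof -
  have a: "a \<in> carrier P" using assms by (simp add: monic_UP_def P_def)
  have "\<exists>u\<in>carrier P. \<exists>v\<in>carrier P. \<one>\<^bsub>P\<^esub> = u \<otimes>\<^bsub>P\<^esub> a \<oplus>\<^bsub>P\<^esub> v \<otimes>\<^bsub>P\<^esub> \<one>\<^bsub>P\<^esub>"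
    by (rule bexI[of _ "\<zero>\<^bsub>P\<^esub>"], rule bexI[of _ "\<one>\<^bsub>P\<^esub>"]) (use a in simp_all)
  hence "Idl\<^bsub>P\<^esub> {a, \<one>\<^bsub>P\<^esub>} = Idl\<^bsub>P\<^esub> {\<one>\<^bsub>P\<^esub>}"
    using a by (subst P.genideal_insert_eq_genideal_iff) (auto simp: factor_def)
  thus ?thesis using assms monic_UP_one by (simp add: is_gcmd_def P_def[symmetric])
qed

lemma subst_X_pow_ring_hom: "subst_X_pow R k \<in> Ring.ring_hom P P"
proof -
  interpret E: UP_pre_univ_prop R P "\<lambda>a. UnivPoly.monom P a 0"
    by (rule UP_pre_univ_propI[OF R.is_cring P.is_cring const_ring_hom]) (rule P_def)
  show ?thesis
    using E.eval_ring_hom[of "X_pow R k"]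
    by (simp add: subst_X_pow_def[abs_def] X_pow_def P_def[symmetric])
qed

lemma divides_subst_X_pow_mult:
  assumes "p \<in> carrier P" "q \<in> carrier P"
    and "p divides\<^bsub>P\<^esub> subst_X_pow R k p" "q divides\<^bsub>P\<^esub> subst_X_pow R k q"
  shows "p \<otimes>\<^bsub>P\<^esub> q divides\<^bsub>P\<^esub> subst_X_pow R k (p \<otimes>\<^bsub>P\<^esub> q)"
proof -
  obtain x y where "x \<in> carrier P" "subst_X_pow R k p = p \<otimes>\<^bsub>P\<^esub> x"
    "y \<in> carrier P" "subst_X_pow R k q = q \<otimes>\<^bsub>P\<^esub> y"
    using assms(3,4) unfolding factor_def by blast
  moreover from this have "p \<otimes>\<^bsub>P\<^esub> x \<otimes>\<^bsub>P\<^esub> (q \<otimes>\<^bsub>P\<^esub> y) = p \<otimes>\<^bsub>P\<^esub> q \<otimes>\<^bsub>P\<^esub> (x \<otimes>\<^bsub>P\<^esub> y)"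
    using assms(1,2) by (simp add: P.m_ac)
  ultimately show ?thesis
    using assms(1,2) ring_hom_mult[OF subst_X_pow_ring_hom]
    by (intro dividesI[of "x \<otimes>\<^bsub>P\<^esub> y"]) auto
qed

lemma divides_subst_X_pow_one: "\<one>\<^bsub>P\<^esub> divides\<^bsub>P\<^esub> subst_X_pow R k \<one>\<^bsub>P\<^esub>"
  using ring_hom_one[OF subst_X_pow_ring_hom] by simp

end

section \<open>Reduction of integer polynomials modulo \<open>n\<close>\<close>

lemma reduce_mod_ring_hom:
  fixes n :: int
  assumes "n > 1"
  defines "P \<equiv> UP (residue_ring n)"
  shows reduce_mod_closed: "reduce_mod n f \<in> carrier P"
    and reduce_mod_mult: "reduce_mod n (f * g) = reduce_mod n f \<otimes>\<^bsub>P\<^esub> reduce_mod n g"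
    and reduce_mod_add: "reduce_mod n (f + g) = reduce_mod n f \<oplus>\<^bsub>P\<^esub> reduce_mod n g"
    and reduce_mod_one: "reduce_mod n 1 = \<one>\<^bsub>P\<^esub>"
proof -
  interpret residues n "residue_ring n" by unfold_locales (use assms in auto)
  interpret UP_cring "residue_ring n" P by unfold_locales (simp add: P_def)
  have up: "reduce_mod n f \<in> up (residue_ring n)" for f
  proof (rule mem_upI)
    show "reduce_mod n f i \<in> carrier (residue_ring n)" for i by (simp add: reduce_mod_def)
    show "\<exists>k. bound \<zero>\<^bsub>residue_ring n\<^esub> k (reduce_mod n f)"
      by (rule exI[of _ "degree f"], rule bound.intro)
        (simp add: reduce_mod_def res_zero_eq coeff_eq_0)
  qed
  thus closed: "reduce_mod n f \<in> carrier P" for f by (simp add: P_def UP_def)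
  have coeff: "UnivPoly.coeff P (reduce_mod n f) i = Polynomial.coeff f i mod n" for f i
    using up[of f] by (simp add: P_def UP_def reduce_mod_def)
  show "reduce_mod n (f * g) = reduce_mod n f \<otimes>\<^bsub>P\<^esub> reduce_mod n g"
    by (rule up_eqI) (simp_all add: closed coeff mult_cong sum_cong coeff_mult Polynomial.coeff_mult)
  show "reduce_mod n (f + g) = reduce_mod n f \<oplus>\<^bsub>P\<^esub> reduce_mod n g"
    by (rule up_eqI) (simp_all add: closed coeff add_cong)
  show "reduce_mod n 1 = \<one>\<^bsub>P\<^esub>"
    by (rule up_eqI) (use assms(1) in \<open>simp_all add: closed coeff res_one_eq res_zero_eq\<close>)
qed

section \<open>Products of Frobenius pseudoprimes\<close>

text \<open>The resultant is a combination of \<open>f\<close> and \<open>g\<close> and a unit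
  modulo \<open>n\<close>; scaling that combination by an inverse of the resultant gives 1 after
  reduction.\<close>

lemma reduce_mod_comaximal:
  fixes f g :: "int poly"
  assumes n: "n > 1" and monic: "lead_coeff f = 1" "lead_coeff g = 1"
    and coprime: "coprime n (resultant f g)"
  defines "P \<equiv> UP (residue_ring n)"
  shows "\<exists>s\<in>carrier P. \<exists>t\<in>carrier P.
    s \<otimes>\<^bsub>P\<^esub> reduce_mod n f \<oplus>\<^bsub>P\<^esub> t \<otimes>\<^bsub>P\<^esub> reduce_mod n g = \<one>\<^bsub>P\<^esub>"
proof -
  note red = reduce_mod_ring_hom[OF n, folded P_def]
  obtain p q where pq: "[:resultant f g:] = p * f + q * g"
  \<comment> \<open>Two constants are outside the scope of \<open>resultant_mem_ideal\<close>, but a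
    monic constant is 1.\<close>
  proof (cases "degree f + degree g = 0")
    case True
    then obtain c where c: "f = [:c:]" by (auto elim: degree_eq_zeroE)
    with monic(1) have "f = 1" by simp
    hence "[:resultant f g:] = 1 * f + 0 * g" by (simp add: pCons_one)
    thus ?thesis by (rule that)
  next
    case False
    thus ?thesis using resultant_mem_ideal that by blast
  qed
  obtain x where x: "[resultant f g * x = 1] (mod n)"
    using cong_solve_coprime_int[of "resultant f g" n] coprime by (auto simp: coprime_commute)
  have "smult x p * f + smult x q * g = smult x [:resultant f g:]"
    by (simp only: pq smult_add_right mult_smult_left)
  hence "reduce_mod n (smult x p * f + smult x q * g) = reduce_mod n 1"
    using x by (simp add: reduce_mod_def fun_eq_iff coeff_pCons cong_def mult.commute split: nat.splits)
  hence "reduce_mod n (smult x p) \<otimes>\<^bsub>P\<^esub> reduce_mod n f \<oplus>\<^bsub>P\<^esub> reduce_mod n (smult x q) \<otimes>\<^bsub>P\<^esub> reduce_mod n g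
      = \<one>\<^bsub>P\<^esub>"
    unfolding red(2-4) .
  thus ?thesis using red(1) by blast
qed

text \<open>
  Padding with \<open>1\<close> beyond \<open>degree f\<close> gives the sequences of two polynomials of different degrees a
  common index range.
\<close>

definition pad :: "nat \<Rightarrow> 'a \<Rightarrow> (nat \<Rightarrow> 'a) \<Rightarrow> nat \<Rightarrow> 'a" where
  "pad k x s i = (if i \<le> k then s i else x)"

text \<open>The padded sequences satisfy the recursion at every index from 1 on, so those of
  \<open>f\<close> and \<open>g\<close> can be multiplied index by index. The last conclusion passes
  comaximality from \<open>f\<close> and \<open>g\<close> to their successive quotients.\<close>

lemma factorization_step_pad:
  assumes n: "n > 1" and fact: "factorization_step n f F fs"
  defines "R \<equiv> residue_ring n"
  defines "P \<equiv> UP R"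
  defines "F' \<equiv> pad (degree f) \<one>\<^bsub>P\<^esub> F" and "fs' \<equiv> pad (degree f) \<one>\<^bsub>P\<^esub> fs"
  shows "fs' 0 = reduce_mod n f"
    and "\<And>i. i \<ge> 1 \<Longrightarrow> is_gcmd R (X_pow R (nat n ^ i) \<ominus>\<^bsub>P\<^esub> X_pow R 1) (fs' (i - 1)) (F' i)"
    and "\<And>i. i \<ge> 1 \<Longrightarrow> fs' (i - 1) = F' i \<otimes>\<^bsub>P\<^esub> fs' i"
    and "\<And>i. i \<ge> degree f \<Longrightarrow> fs' i = \<one>\<^bsub>P\<^esub>"
    and "\<And>i. fs' i \<in> carrier P"
    and "\<And>i. \<exists>c\<in>carrier P. reduce_mod n f = c \<otimes>\<^bsub>P\<^esub> fs' i"
proof -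
  note F'_def = F'_def[THEN meta_eq_to_obj_eq, THEN fun_cong, unfolded pad_def]
  note fs'_def = fs'_def[THEN meta_eq_to_obj_eq, THEN fun_cong, unfolded pad_def]
  interpret residues n R by unfold_locales (use n R_def in auto)
  interpret UP_cring R P by unfold_locales (simp add: P_def)
  have nat: "1 < nat n ^ i" if "i \<ge> 1" for i using n that by (intro one_less_power) auto
  have ntriv: "\<one>\<^bsub>R\<^esub> \<noteq> \<zero>\<^bsub>R\<^esub>" by (simp add: res_one_eq res_zero_eq)
  note fact = fact[unfolded factorization_step_def Let_def, folded R_def, folded P_def]
  have fs0: "fs' 0 = reduce_mod n f" using fact by (simp add: fs'_def)
  have pad: "is_gcmd R (X_pow R (nat n ^ i) \<ominus>\<^bsub>P\<^esub> X_pow R 1) (fs' (i - 1)) (F' i) \<and>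
      fs' (i - 1) = F' i \<otimes>\<^bsub>P\<^esub> fs' i \<and> fs' i \<in> carrier P" if "i \<ge> 1" for i
  proof (cases "i \<le> degree f")
    case True
    hence "i \<in> {1..degree f}" and le: "i - 1 \<le> degree f" using that by auto
    from bspec[OF conjunct1[OF conjunct2[OF fact]] this(1)] show ?thesis
      unfolding fs'_def F'_def if_P[OF True] if_P[OF le] by blast
  next
    case False
    \<comment> \<open>At \<open>i - 1 = degree f\<close> this is the termination clause of the
      factorization step; at larger indices it is the padding value.\<close>
    hence "fs' (i - 1) = \<one>\<^bsub>P\<^esub>" using fact by (cases "i - 1 = degree f") (auto simp: fs'_def)
    thus ?thesis using False is_gcmd_one[OF monic_UP_X_pow_minus_X[OF ntriv nat[OF that]]]
      by (simp add: fs'_def F'_def)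
  qed
  have one: "fs' i = \<one>\<^bsub>P\<^esub>" if "i \<ge> degree f" for i
    using fact that by (cases "i = degree f") (auto simp: fs'_def)
  have red: "reduce_mod n f \<in> carrier P" using reduce_mod_closed[OF n] by (simp add: P_def R_def)
  have car: "fs' i \<in> carrier P" for i
    using pad[of i] fs0 red by (cases "i = 0") auto
  \<comment> \<open>The cofactor built up by the induction is the product of \<open>F' 1\<close> to
    \<open>F' i\<close>.\<close>
  have dvd: "\<exists>c\<in>carrier P. reduce_mod n f = c \<otimes>\<^bsub>P\<^esub> fs' i" for i
  proof (induction i)
    case 0
    show ?case by (rule bexI[of _ "\<one>\<^bsub>P\<^esub>"]) (use red fs0 in simp_all)
  next
    case (Suc i)
    then obtain c where c: "c \<in> carrier P" "reduce_mod n f = c \<otimes>\<^bsub>P\<^esub> fs' i" by blast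
    have F: "F' (Suc i) \<in> carrier P" "fs' i = F' (Suc i) \<otimes>\<^bsub>P\<^esub> fs' (Suc i)"
      using pad[of "Suc i"] by (auto simp: is_gcmd_def monic_UP_def P_def)
    show ?case
      by (rule bexI[of _ "c \<otimes>\<^bsub>P\<^esub> F' (Suc i)"]) (use c F car in \<open>simp_all add: P.m_assoc\<close>)
  qed
  show "fs' 0 = reduce_mod n f" by (rule fs0)
  show "is_gcmd R (X_pow R (nat n ^ i) \<ominus>\<^bsub>P\<^esub> X_pow R 1) (fs' (i - 1)) (F' i)" if "i \<ge> 1" for i
    using pad[OF that] by blast
  show "fs' (i - 1) = F' i \<otimes>\<^bsub>P\<^esub> fs' i" if "i \<ge> 1" for i
    using pad[OF that] by blast
  show "fs' i = \<one>\<^bsub>P\<^esub>" if "i \<ge> degree f" for i using that by (rule one)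
  show "fs' i \<in> carrier P" for i by (rule car)
  show "\<exists>c\<in>carrier P. reduce_mod n f = c \<otimes>\<^bsub>P\<^esub> fs' i" for i by (rule dvd)
qed

theorem theorem4p6:
  fixes f g :: "int poly" and n :: int
  assumes "lead_coeff f = 1" and "lead_coeff g = 1"
    and "coprime n (monic_disc (f * g))"
    and "frobenius_pseudoprime n f" and "frobenius_pseudoprime n g"
  shows "frobenius_pseudoprime n (f * g)"
proof -
  define R where "R = residue_ring n"
  define P where "P = UP R"
  have disc: "monic_disc (f * g) = monic_disc f * monic_disc g * (resultant f g)\<^sup>2"
    using assms(1,2) by (rule monic_disc_mult)
  have n: "odd n" "n > 1" and comp: "\<not> Factorial_Ring.prime n"
    and cop: "coprime n (poly f 0 * monic_disc f)" "coprime n (poly g 0 * monic_disc g)"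
    using assms(4,5) by (auto simp: frobenius_pseudoprime_def frobenius_probable_prime_def)
  obtain F fs where Ffs: "factorization_step n f F fs" "frobenius_step n f F" "jacobi_step n f F"
    using assms(4) by (auto simp: frobenius_pseudoprime_def frobenius_probable_prime_def)
  obtain G gs where Ggs: "factorization_step n g G gs" "frobenius_step n g G" "jacobi_step n g G"
    using assms(5) by (auto simp: frobenius_pseudoprime_def frobenius_probable_prime_def)
  interpret residues n R by unfold_locales (use n R_def in auto)
  interpret UP_cring R P by unfold_locales (simp add: P_def)
  have ntriv: "\<one>\<^bsub>R\<^esub> \<noteq> \<zero>\<^bsub>R\<^esub>" by (simp add: res_one_eq res_zero_eq)
  define F' where "F' = pad (degree f) \<one>\<^bsub>P\<^esub> F"
  define fs' where "fs' = pad (degree f) \<one>\<^bsub>P\<^esub> fs"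
  define G' where "G' = pad (degree g) \<one>\<^bsub>P\<^esub> G"
  define gs' where "gs' = pad (degree g) \<one>\<^bsub>P\<^esub> gs"
  note f = factorization_step_pad[OF n(2) Ffs(1), folded R_def, folded P_def, folded F'_def fs'_def]
  note g = factorization_step_pad[OF n(2) Ggs(1), folded R_def, folded P_def, folded G'_def gs'_def]
  have F': "i \<le> degree f \<Longrightarrow> F' i = F i" "i > degree f \<Longrightarrow> F' i = \<one>\<^bsub>P\<^esub>"
    and G': "i \<le> degree g \<Longrightarrow> G' i = G i" "i > degree g \<Longrightarrow> G' i = \<one>\<^bsub>P\<^esub>" for i
    by (simp_all add: F'_def G'_def pad_def)
  have nz: "f \<noteq> 0" "g \<noteq> 0" using assms(1,2) by auto
  have deg: "degree (f * g) = degree f + degree g" using nz by (rule degree_mult_eq)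
  \<comment> \<open>The square of the resultant is a factor of disc(fg).\<close>
  have res: "coprime n (resultant f g)"
    using assms(3) unfolding disc by (simp add: power2_eq_square)
  obtain s t where st: "s \<in> carrier P" "t \<in> carrier P"
    "s \<otimes>\<^bsub>P\<^esub> reduce_mod n f \<oplus>\<^bsub>P\<^esub> t \<otimes>\<^bsub>P\<^esub> reduce_mod n g = \<one>\<^bsub>P\<^esub>"
    using reduce_mod_comaximal[OF n(2) assms(1,2) res] unfolding P_def R_def by blast
  have monic: "monic_UP R (F' i)" "monic_UP R (G' i)" if "i \<ge> 1" for i
    using f(2)[OF that] g(2)[OF that] unfolding is_gcmd_def by blast+
  have car: "F' i \<in> carrier P" "G' i \<in> carrier P" if "i \<ge> 1" for i
    using monic[OF that] unfolding monic_UP_def P_def by blast+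
  define H where "H = (\<lambda>i. F' i \<otimes>\<^bsub>P\<^esub> G' i)"
  define hs where "hs = (\<lambda>i. fs' i \<otimes>\<^bsub>P\<^esub> gs' i)"

  have "is_gcmd R (X_pow R (nat n ^ i) \<ominus>\<^bsub>P\<^esub> X_pow R 1) (hs (i - 1)) (H i)" if i: "i \<ge> 1" for i
  proof -
    \<comment> \<open>Absorbing the cofactors \<open>c\<close> and \<open>d\<close> into
      \<open>s\<close> and \<open>t\<close> turns the Bezout identity of \<open>f\<close> and
      \<open>g\<close> into one for the current quotients, as \<open>is_gcmd_mult\<close>
      requires.\<close>
    obtain c where c: "c \<in> carrier P" "reduce_mod n f = c \<otimes>\<^bsub>P\<^esub> fs' (i - 1)" using f(6) by blast
    obtain d where d: "d \<in> carrier P" "reduce_mod n g = d \<otimes>\<^bsub>P\<^esub> gs' (i - 1)" using g(6) by blast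
    have "(s \<otimes>\<^bsub>P\<^esub> c) \<otimes>\<^bsub>P\<^esub> fs' (i - 1) \<oplus>\<^bsub>P\<^esub> (t \<otimes>\<^bsub>P\<^esub> d) \<otimes>\<^bsub>P\<^esub> gs' (i - 1) = \<one>\<^bsub>P\<^esub>"
      using st(3) unfolding c(2) d(2) using st(1,2) c(1) d(1) f(5) g(5) by (simp add: P.m_assoc)
    thus ?thesis
      unfolding H_def hs_def using st(1,2) c(1) d(1)
      by (intro is_gcmd_mult[OF ntriv f(2)[OF i] g(2)[OF i], of "s \<otimes>\<^bsub>P\<^esub> c" "t \<otimes>\<^bsub>P\<^esub> d"]) simp_all
  qed
  moreover have "hs (i - 1) = H i \<otimes>\<^bsub>P\<^esub> hs i" if i: "i \<ge> 1" for i
    unfolding H_def hs_def f(3)[OF i] g(3)[OF i]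
    using car[OF i] f(5) g(5) by (simp add: P.m_ac)
  moreover have "hs 0 = reduce_mod n (f * g)"
    unfolding hs_def f(1) g(1) using reduce_mod_mult[OF n(2)] by (simp add: P_def R_def)
  moreover have "hs (degree (f * g)) = \<one>\<^bsub>P\<^esub>"
    unfolding hs_def deg by (simp add: f(4) g(4))
  moreover have "hs i \<in> carrier P" for i unfolding hs_def using f(5) g(5) by simp
  ultimately have fact: "factorization_step n (f * g) H hs"
    unfolding factorization_step_def Let_def R_def[symmetric] P_def[symmetric] by auto

  have frob: "frobenius_step n (f * g) H"
    unfolding frobenius_step_def Let_def R_def[symmetric] P_def[symmetric]
  proof
    fix i assume i: "i \<in> {2..degree (f * g)}"
    have "F' i divides\<^bsub>P\<^esub> subst_X_pow R (nat n) (F' i)"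
    proof (cases "i \<le> degree f")
      case True
      thus ?thesis using Ffs(2) i F'(1)[OF True]
        by (simp add: frobenius_step_def Let_def R_def[symmetric] P_def[symmetric])
    qed (simp add: F'(2) divides_subst_X_pow_one)
    moreover have "G' i divides\<^bsub>P\<^esub> subst_X_pow R (nat n) (G' i)"
    proof (cases "i \<le> degree g")
      case True
      thus ?thesis using Ggs(2) i G'(1)[OF True]
        by (simp add: frobenius_step_def Let_def R_def[symmetric] P_def[symmetric])
    qed (simp add: G'(2) divides_subst_X_pow_one)
    ultimately show "H i divides\<^bsub>P\<^esub> subst_X_pow R (nat n) (H i)"
      unfolding H_def using i car[of i] by (intro divides_subst_X_pow_mult) auto
  qed

  obtain S where S: "(of_nat S :: rat) =
      (\<Sum>i | i \<in> {1..degree f} \<and> even i. of_nat (deg R (F i)) / of_nat i)" "(-1) ^ S = Jacobi (monic_disc f) n"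
    using Ffs(3) unfolding jacobi_step_def R_def[symmetric] by blast
  obtain T where T: "(of_nat T :: rat) =
      (\<Sum>i | i \<in> {1..degree g} \<and> even i. of_nat (deg R (G i)) / of_nat i)" "(-1) ^ T = Jacobi (monic_disc g) n"
    using Ggs(3) unfolding jacobi_step_def R_def[symmetric] by blast
  let ?I = "{i. i \<in> {1..degree (f * g)} \<and> even i}"
  \<comment> \<open>The padded factors beyond \<open>degree f\<close> are 1, of degree 0, so the
    longer range adds only zero terms.\<close>
  have "of_nat S = (\<Sum>i\<in>?I. of_nat (deg R (F' i)) / of_nat i :: rat)"
    unfolding S(1) by (rule sum.mono_neutral_cong_left) (auto simp: F'_def pad_def deg)
  moreover have "of_nat T = (\<Sum>i\<in>?I. of_nat (deg R (G' i)) / of_nat i :: rat)"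
    unfolding T(1) by (rule sum.mono_neutral_cong_left) (auto simp: G'_def pad_def deg)
  ultimately have "of_nat (S + T) = (\<Sum>i\<in>?I. of_nat (deg R (F' i)) / of_nat i + of_nat (deg R (G' i)) / of_nat i :: rat)"
    by (simp add: sum.distrib)
  also have "\<dots> = (\<Sum>i\<in>?I. of_nat (deg R (H i)) / of_nat i)"
    unfolding H_def
    by (intro sum.cong refl) (auto simp: deg_mult_monic[OF ntriv monic] add_divide_distrib)
  finally have "of_nat (S + T) = (\<Sum>i\<in>?I. of_nat (deg R (H i)) / of_nat i :: rat)" .
  moreover have "(-1) ^ (S + T) = Jacobi (monic_disc (f * g)) n"
    unfolding disc power_add S(2) T(2) using n res by (simp add: Jacobi_mult Jacobi_square)
  ultimately have "jacobi_step n (f * g) H"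
    unfolding jacobi_step_def R_def[symmetric] by blast
  moreover have "coprime n (poly (f * g) 0 * monic_disc (f * g))"
    using cop assms(3) by simp
  ultimately show ?thesis
    using fact frob n comp unfolding frobenius_pseudoprime_def frobenius_probable_prime_def by blast
qed

end
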